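(* For a fixed integer $m\ge 3$ and an integer $n\ge\lceil\sqrt[3]{2}\cdot m^{4/3}+m\rceil$, consider the polynomial $$G(z):=c_0+c_1z+\sum_{j=2}^{n-m+1}c_jz^{d_j},$$ where $c_0,c_1,\ldots,c_{n-m+1}$ are real or complex coefficients satisfying $$|c_0|\ge\binom{n+1}{m-1},\qquad |c_j|\le\binom{n}{m+j-1}\quad\text{for}\quad 1\le j\le n-m+1,$$ and $d_2,\ldots,d_{n-m+1}$ are positive integers satisfying $$d_j\ge (m+1)(j-1),\qquad j=2,3,\ldots,n-m+1.$$ Then the (complex) zeros of $G(z)$ lie outside the circle about the origin with radius $m/(n-m+1)$, i.e., every zero satisfies $|z|>m/(n-m+1)$. *)

theory Defs
  imports Complex_Main "HOL-Computational_Algebra.Polynomial"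
begin

text \<open>
  The number \<open>N\<close> is the last index of the sum, which will be \<open>n - m + 1\<close>.
  The exponents \<open>d j\<close> need not be distinct or increasing, so terms may coincide in degree;
  \<open>d 0\<close> and \<open>d 1\<close> are irrelevant.
\<close>

definition G_poly :: "(nat \<Rightarrow> complex) \<Rightarrow> (nat \<Rightarrow> nat) \<Rightarrow> nat \<Rightarrow> complex poly" where
  "G_poly c d N = [:c 0:] + monom (c 1) 1 + (\<Sum>j = 2..N. monom (c j) (d j))"

end

theory Submission
  imports Defs
begin

text \<open>
  Put \<open>N = n - m + 1\<close> and \<open>r = m / N\<close>. On the disc \<open>cmod z \<le> r\<close> the constant term dominates. The
  radius is chosen such that \<open>(n choose m) * r = n choose (m - 1)\<close>, so by Pascal's rule, what
  is left of \<open>c 0\<close> after the linear term has been subtracted is \<open>n choose (m - 2)\<close>. The remaining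
  terms are bounded by a geometric series, since \<open>(n choose (m + k)) * r ^ ((m + 1) * k)\<close> is at most
  \<open>(n choose m) * q ^ k\<close> with \<open>q = (N - 1) / (m + 1) * r ^ (m + 1)\<close>. The hypothesis on \<open>n\<close>
  gives \<open>N ^ 3 > 2 * m ^ 4\<close>, hence \<open>r ^ 3 < 1 / 6\<close>, which makes the series small enough.
\<close>

lemma binomial_Suc_ratio:
  "real (Suc k) * real (n choose Suc k) = (real n - real k) * real (n choose k)"
proof (cases "k \<le> n")
  case True
  have "Suc k * (n choose Suc k) = (n - k) * (n choose k)"
    by (simp only: binomial_absorption binomial_absorb_comp)
  then have "real (Suc k * (n choose Suc k)) = real ((n - k) * (n choose k))"
    by simp
  then show ?thesis
    using True by (simp only: of_nat_mult of_nat_diff)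
qed (simp add: binomial_eq_0)

text \<open>The quotient of consecutive binomials, \<open>(n - m - k) / (m + k + 1)\<close>,
  decreases in \<open>k\<close>, so every quotient is at most the one at \<open>k = 0\<close>.
  Beyond \<open>n\<close> the binomials vanish.\<close>

lemma binomial_le_geometric:
  assumes "m \<le> n"
  shows "real (n choose (m + k)) \<le> real (n choose m) * ((real n - real m) / (real m + 1)) ^ k"
proof (induction k)
  case (Suc k)
  let ?t = "(real n - real m) / (real m + 1)"
  have "real (n choose Suc (m + k)) \<le> real (n choose (m + k)) * ?t"
  proof (cases "m + k \<le> n")
    case True
    have "real (n choose Suc (m + k))
        = real (n choose (m + k)) * ((real n - real (m + k)) / real (Suc (m + k)))"
      using binomial_Suc_ratio[of "m + k" n] by (simp add: field_simps)
    also have "\<dots> \<le> real (n choose (m + k)) * ?t"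
      using True by (intro mult_left_mono frac_le) auto
    finally show ?thesis .
  qed (use assms in \<open>simp add: binomial_eq_0\<close>)
  also have "\<dots> \<le> real (n choose m) * ?t ^ k * ?t"
    using assms Suc.IH by (intro mult_right_mono) auto
  finally show ?case
    by (simp add: mult_ac)
qed simp

lemma sum_geometric_bound:
  fixes q :: real
  assumes "0 \<le> q" "q < 1"
  shows "(\<Sum>k = 1..K. q ^ k) \<le> q / (1 - q)"
proof (cases "1 \<le> K")
  case True
  then have "(1 - q) * (\<Sum>k = 1..K. q ^ k) \<le> q"
    using assms by (simp only: sum_gp_multiplied) simp
  then show ?thesis
    using assms by (simp add: pos_le_divide_eq mult.commute)
qed (use assms in simp)

text \<open>The bound is uniform in \<open>K\<close> because the finite sum is compared with the
  full geometric series. The hypothesis \<open>cube\<close> enters as \<open>r ^ 3 < 1 / 6\<close>,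
  which controls both \<open>r\<close> and the ratio \<open>q\<close>.\<close>

lemma binomial_tail_less:
  fixes m n :: nat
  defines "N \<equiv> real n - real m + 1"
  defines "r \<equiv> real m / N"
  assumes m: "m \<ge> 3" and mn: "m < n" and cube: "6 * real m ^ 3 < N ^ 3"
  shows "(\<Sum>k = 1..K. real (n choose (m + k)) * r ^ ((m + 1) * k)) < real (n choose (m - 2))"
proof -
  have N: "N > 1"
    using mn by (simp add: N_def)
  have r0: "0 < r"
    using N m by (simp add: r_def)
  have r3: "r ^ 3 < 1 / 6"
    using cube N by (simp add: r_def power_divide field_simps)
  \<comment> \<open>A rational slightly above the cube root of \<open>1 / 6\<close>, small enough
    that \<open>9 / 8 * (56 / 100) = 63 / 100\<close> stays below \<open>5 / 6 < 1 - q\<close> in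
    \<open>key\<close>.\<close>
  have r: "r < 56 / 100"
  proof (rule ccontr)
    assume "\<not> ?thesis"
    then have "(56 / 100) ^ 3 \<le> r ^ 3"
      by (intro power_mono) auto
    with r3 show False
      by (simp add: power3_eq_cube)
  qed
  define t where "t = (N - 1) / (real m + 1)"
  define q where "q = t * r ^ (m + 1)"
  \<comment> \<open>The product \<open>t * r\<close> is \<open>(N - 1) / N\<close> times
    \<open>m / (m + 1)\<close>. One factor \<open>r\<close> thus absorbs \<open>t\<close>, leaving
    \<open>q\<close> at most \<open>r ^ m\<close>.\<close>
  have t0: "0 < t" and tr: "t * r \<le> 1"
  proof -
    have "(N - 1) * real m \<le> (real m + 1) * N"
      using N by (simp add: algebra_simps)
    then have "(N - 1) * real m / ((real m + 1) * N) \<le> 1"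
      using N by (subst divide_le_eq_1_pos) auto
    then show "t * r \<le> 1"
      by (simp add: t_def r_def)
  qed (use N in \<open>simp add: t_def\<close>)
  have q0: "0 < q"
    using t0 r0 by (simp add: q_def)
  have "q = t * r * r ^ m"
    by (simp add: q_def)
  also have "\<dots> \<le> 1 * r ^ 3"
    using tr r0 r m t0 by (intro mult_mono power_decreasing) auto
  finally have q: "q < 1 / 6"
    using r3 by simp
  \<comment> \<open>This is the final estimate with the binomials cancelled via \<open>Cm\<close>
    and \<open>Cm1\<close>. It is proved after multiplication by \<open>m + 1\<close>, which turns
    \<open>t\<close> into \<open>N - 1\<close> and \<open>m - 1\<close> into
    \<open>m\<^sup>2 - 1\<close>.\<close>
  have key: "t * (N + 1) * r ^ m < (real m - 1) * (1 - q)"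
  proof -
    \<comment> \<open>Equivalent to \<open>m\<^sup>2 \<ge> 9\<close>; it produces the factor
      \<open>m\<^sup>2 - 1\<close> that the right-hand side carries.\<close>
    have m2: "8 * (real m)\<^sup>2 \<le> 9 * ((real m)\<^sup>2 - 1)"
      using mult_mono[of 3 "real m" 3 "real m"] m by (simp add: power2_eq_square)
    have "(N\<^sup>2 - 1) * r ^ m \<le> N\<^sup>2 * r ^ 3"
      using N r0 r m by (intro mult_mono power_decreasing) auto
    also have "\<dots> = (real m)\<^sup>2 * r"
      using N by (simp add: r_def power2_eq_square power3_eq_cube)
    also have "\<dots> \<le> (9 / 8 * ((real m)\<^sup>2 - 1)) * (56 / 100)"
      using m2 r r0 m by (intro mult_mono) auto
    also have "\<dots> < ((real m)\<^sup>2 - 1) * (1 - q)"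
    proof -
      have "(real m)\<^sup>2 - 1 > 0"
        using m power_strict_mono[of 1 "real m" 2] by simp
      then have "((real m)\<^sup>2 - 1) * (63 / 100) < ((real m)\<^sup>2 - 1) * (1 - q)"
        using q by (intro mult_strict_left_mono) auto
      then show ?thesis by simp
    qed
    finally have "(N - 1) * (N + 1) * r ^ m < (real m + 1) * ((real m - 1) * (1 - q))"
      by (simp add: power2_eq_square algebra_simps)
    then show ?thesis
      by (simp add: t_def field_simps)
  qed
  have Cm: "real (n choose m) * r = real (n choose (m - 1))"
    using binomial_Suc_ratio[of "m - 1" n] m N by (simp add: r_def N_def of_nat_diff field_simps)
  have "Suc (m - 2) = m - 1" using m by simp
  then have Cm1: "(real m - 1) * real (n choose (m - 1)) = (N + 1) * real (n choose (m - 2))"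
    using binomial_Suc_ratio[of "m - 2" n] m by (simp add: N_def of_nat_diff)
  have B0: "0 < real (n choose m)"
    using mn by simp
  have "(\<Sum>k = 1..K. real (n choose (m + k)) * r ^ ((m + 1) * k))
      \<le> (\<Sum>k = 1..K. real (n choose m) * q ^ k)"
  proof (rule sum_mono)
    fix k
    have "real (n choose (m + k)) \<le> real (n choose m) * t ^ k"
      using binomial_le_geometric[of m n k] mn by (simp add: t_def N_def)
    then have "real (n choose (m + k)) * r ^ ((m + 1) * k)
        \<le> real (n choose m) * t ^ k * r ^ ((m + 1) * k)"
      using r0 by (intro mult_right_mono) auto
    then show "real (n choose (m + k)) * r ^ ((m + 1) * k) \<le> real (n choose m) * q ^ k"
      by (simp only: q_def power_mult power_mult_distrib mult.assoc)
  qed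
  also have "\<dots> \<le> real (n choose m) * (q / (1 - q))"
    unfolding sum_distrib_left[symmetric]
    using q q0 by (intro mult_left_mono sum_geometric_bound) auto
  also have "\<dots> < real (n choose (m - 2))"
  proof -
    \<comment> \<open>One \<open>r\<close> is split off from \<open>q\<close> so that
      \<open>(n choose m) * r\<close> becomes \<open>n choose (m - 1)\<close>, and the factor
      \<open>m - 1\<close> from \<open>key\<close> then leads to
      \<open>n choose (m - 2)\<close>.\<close>
    have "(N + 1) * (real (n choose m) * q) = real (n choose m) * r * (t * (N + 1) * r ^ m)"
      by (simp add: q_def)
    also have "\<dots> < real (n choose m) * r * ((real m - 1) * (1 - q))"
      using key B0 r0 by (intro mult_strict_left_mono) auto
    also have "\<dots> = (N + 1) * (real (n choose (m - 2)) * (1 - q))"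
      using Cm Cm1 by (simp add: mult_ac)
    finally have "real (n choose m) * q < real (n choose (m - 2)) * (1 - q)"
      using N by simp
    then show ?thesis
      using q by (simp add: field_simps)
  qed
  finally show ?thesis .
qed

lemma poly_G_poly:
  "poly (G_poly c d N) z = c 0 + c 1 * z + (\<Sum>j = 2..N. c j * z ^ d j)"
  by (simp add: G_poly_def poly_monom poly_sum)

theorem proposition5p3:
  fixes m n :: nat and c :: "nat \<Rightarrow> complex" and d :: "nat \<Rightarrow> nat"
  assumes "m \<ge> 3"
    and "int n \<ge> \<lceil>root 3 2 * real m powr (4 / 3) + real m\<rceil>"
    and "cmod (c 0) \<ge> real ((n + 1) choose (m - 1))"
    and "\<And>j. 1 \<le> j \<Longrightarrow> j \<le> n - m + 1 \<Longrightarrow> cmod (c j) \<le> real (n choose (m + j - 1))"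
    and "\<And>j. 2 \<le> j \<Longrightarrow> j \<le> n - m + 1 \<Longrightarrow> d j > 0"
    and "\<And>j. 2 \<le> j \<Longrightarrow> j \<le> n - m + 1 \<Longrightarrow> d j \<ge> (m + 1) * (j - 1)"
  shows "\<forall>z::complex. poly (G_poly c d (n - m + 1)) z = 0 \<longrightarrow>
           cmod z > real m / (real n - real m + 1)"
proof (intro allI impI, rule ccontr)
  fix z :: complex
  assume zero: "poly (G_poly c d (n - m + 1)) z = 0"
  define N where "N = real n - real m + 1"
  define r where "r = real m / N"
  assume "\<not> cmod z > real m / (real n - real m + 1)"
  then have zr: "cmod z \<le> r"
    by (simp add: r_def N_def)
  define x where "x = root 3 2 * real m powr (4 / 3)"
  have x0: "0 < x"
    using assms(1) by (simp add: x_def)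
  have x3: "x ^ 3 = 2 * real m ^ 4"
  proof -
    have "(real m powr (4 / 3)) ^ 3 = real m ^ 4"
      using assms(1) by (simp add: powr_power)
    then show ?thesis
      by (simp add: x_def power_mult_distrib)
  qed
  have "x + real m \<le> real n"
    using assms(2) unfolding x_def by linarith
  \<comment> \<open>The summand 1 in \<open>N\<close> makes the first inequality strict.\<close>
  then have xN: "x < N" and mn: "m < n"
    using x0 by (simp_all add: N_def)
  have "6 * real m ^ 3 \<le> 2 * real m ^ 4"
    using assms(1) by (simp add: power_numeral_reduce)
  also have "\<dots> < N ^ 3"
    unfolding x3[symmetric] using xN x0 by (intro power_strict_mono) auto
  finally have cube: "6 * real m ^ 3 < N ^ 3" .
  \<comment> \<open>The exponents \<open>d j\<close> are only bounded below, so replacing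
    \<open>r ^ d j\<close> by \<open>r ^ ((m + 1) * (j - 1))\<close> requires
    \<open>r \<le> 1\<close>.\<close>
  have "real m ^ 3 < N ^ 3"
    using cube assms(1) by (smt (verit) of_nat_0_le_iff zero_le_power)
  then have "real m < N"
    using xN x0 by (simp add: power_less_imp_less_base)
  then have r01: "0 \<le> r" "r \<le> 1"
    using xN x0 by (simp_all add: r_def)

  have "c 0 = - (c 1 * z + (\<Sum>j = 2..n - m + 1. c j * z ^ d j))"
    using zero by (simp only: poly_G_poly add.assoc eq_neg_iff_add_eq_0)
  then have "cmod (c 0) = cmod (c 1 * z + (\<Sum>j = 2..n - m + 1. c j * z ^ d j))"
    by (simp only: norm_minus_cancel)
  also have "\<dots> \<le> cmod (c 1 * z) + (\<Sum>j = 2..n - m + 1. cmod (c j * z ^ d j))"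
    by (intro norm_triangle_le add_left_mono norm_sum)
  also have "cmod (c 1 * z) \<le> real (n choose m) * r"
    using assms(4)[of 1] zr by (simp add: norm_mult mult_mono)
  also have "(\<Sum>j = 2..n - m + 1. cmod (c j * z ^ d j))
      \<le> (\<Sum>j = 2..n - m + 1. real (n choose (m + (j - 1))) * r ^ ((m + 1) * (j - 1)))"
  proof (rule sum_mono)
    fix j assume j: "j \<in> {2..n - m + 1}"
    have "cmod z ^ d j \<le> r ^ d j"
      using zr by (simp add: power_mono)
    also have "\<dots> \<le> r ^ ((m + 1) * (j - 1))"
      using assms(6)[of j] j r01 by (intro power_decreasing) auto
    finally show "cmod (c j * z ^ d j)
        \<le> real (n choose (m + (j - 1))) * r ^ ((m + 1) * (j - 1))"
      using assms(4)[of j] j unfolding norm_mult norm_power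
      by (intro mult_mono) auto
  qed
  also have "\<dots> = (\<Sum>k = 1..n - m. real (n choose (m + k)) * r ^ ((m + 1) * k))"
    by (rule sum.reindex_bij_witness[of _ Suc "\<lambda>j. j - 1"]) auto
  also have "\<dots> < real (n choose (m - 2))"
    using binomial_tail_less[OF assms(1) mn] cube by (simp add: N_def r_def)
  also have "real (n choose m) * r = real (n choose (m - 1))"
    using binomial_Suc_ratio[of "m - 1" n] assms(1) xN x0
    by (simp add: r_def N_def of_nat_diff field_simps)
  also have "real (n choose (m - 1)) + real (n choose (m - 2)) = real ((n + 1) choose (m - 1))"
  proof -
    have "Suc (m - 2) = m - 1"
      using assms(1) by simp
    then show ?thesis
      using binomial_Suc_Suc[of n "m - 2"] by simp
  qed
  finally show False
    using assms(3) by simp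
qed

end
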